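(* Let $G=(V,E)$ be a $\{2,4\}$-saturated graph on $n$ vertices, and let $\mathcal C_4$ be the set of $4$-cliques of $G$. Then \[\lvert E\rvert-\lvert\mathcal C_4\rvert\leqslant\left(\frac{2(39+\sqrt{21})}{375}+o(1)\right)n^2<(0.232441+o(1))n^2,\] where $o(1)$ denotes a quantity depending only on $n$ (not on $G$) which tends to $0$ as $n\to\infty$.
   Context: Graphs are finite and simple; a $k$-clique is a set of $k$ pairwise adjacent vertices. A graph is $\{2,4\}$-saturated if every edge is contained in a $4$-clique. *)

theory Defs
  imports Complex_Main "HOL-Library.Ramsey"
begin

definition finite_simple_graph :: "'a set \<Rightarrow> 'a set set \<Rightarrow> bool" where
  "finite_simple_graph V E \<longleftrightarrow> finite V \<and> E \<subseteq> [V]\<^bsup>2\<^esup>"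

definition cliques :: "nat \<Rightarrow> 'a set \<Rightarrow> 'a set set \<Rightarrow> 'a set set" where
  "cliques k V E = {K \<in> [V]\<^bsup>k\<^esup>. clique K E}"

definition saturated_2_4 :: "'a set \<Rightarrow> 'a set set \<Rightarrow> bool" where
  "saturated_2_4 V E \<longleftrightarrow> (\<forall>e\<in>E. \<exists>K\<in>cliques 4 V E. e \<subseteq> K)"

end

theory Submission
  imports Defs
begin

text \<open>
  Let \<open>k\<^sub>e\<close> be the number of 4-cliques through the edge \<open>e\<close>, and call \<open>e\<close> light if \<open>k\<^sub>e\<close> is at
  most a large constant. As \<open>\<Sum>k\<^sub>e = 6 |C\<^sub>4|\<close> and we may assume \<open>|C\<^sub>4| \<le> |E|\<close>, all but a tiny
  proportion of \<open>n\<^sup>2\<close> edges are light. Give \<open>e = uv\<close> the weight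
  \<open>W e = 1 - \<lambda> n (1 / deg u + 1 / deg v)\<close>; the total weight is at least \<open>|E| - \<lambda> n\<^sup>2\<close>.
  By saturation each edge can distribute its weight equally among the \<open>k\<^sub>e \<ge> 1\<close> cliques containing
  it. A triangle with a light edge has boundedly many common neighbours, so the vertices of a
  4-clique all of whose triangles have a light edge have degree sum at most \<open>2n + O(1)\<close>, and by
  Cauchy-Schwarz such a clique receives a weight of at most 1 from its light edges. If a triangle of
  the clique has no light edge, the light edges form a star and the three triangles at its centre
  give the same bound. Hence \<open>|E| - |C\<^sub>4| \<le> (\<lambda> + o(1)) n\<^sup>2\<close>. The value \<open>\<lambda> = 0.231\<close> leaves room for
  all error terms.
\<close>

section \<open>Inequalities for normalised degrees\<close>

text \<open>Expand \<open>(r - t * d)\<^sup>2 \<ge> 0\<close> and divide by \<open>d\<close>. The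
  bound is linear in \<open>d\<close>, so instances with a common \<open>t\<close> add up to a
  Cauchy-Schwarz estimate that sees only the sum of the \<open>d\<close>.\<close>

lemma scaled_inverse_ge_tangent:
  fixes d f k r t :: real
  assumes "0 < d" "r\<^sup>2 \<le> f" "0 \<le> k"
  shows "k * (2 * t * r - t\<^sup>2 * d) \<le> f * (k / d)"
proof -
  have "0 \<le> (r - t * d)\<^sup>2" by simp
  hence "2 * t * r * d - t\<^sup>2 * d * d \<le> r\<^sup>2"
    by (simp add: power2_eq_square algebra_simps)
  hence "(2 * t * r - t\<^sup>2 * d) * d \<le> f"
    using assms by (simp add: algebra_simps)
  hence "2 * t * r - t\<^sup>2 * d \<le> f / d" using assms by (simp add: pos_le_divide_eq)
  from mult_left_mono[OF this \<open>0 \<le> k\<close>] show ?thesis by (simp add: mult.commute)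
qed

text \<open>The arguments stand for the degrees of the two ends divided by n. Cutting the weight off
  at 0 lets edges of negative weight be ignored.\<close>

definition edge_gain :: "real \<Rightarrow> real \<Rightarrow> real" where
  "edge_gain x y = max 0 (1 - 0.231 / x - 0.231 / y)"

lemma edge_gain_nonneg: "0 \<le> edge_gain x y"
  by (simp add: edge_gain_def)

lemma edge_gain_le_1:
  assumes "0 < x" "0 < y"
  shows "edge_gain x y \<le> 1"
proof -
  have "0 \<le> 0.231 / x" "0 \<le> 0.231 / y" using assms by simp_all
  thus ?thesis unfolding edge_gain_def by linarith
qed

text \<open>The pairs with positive gain form one of the eight threshold graphs on four vertices; each
  fact below is the Cauchy-Schwarz bound for one of them, with \<open>\<surd>2\<close> and \<open>\<surd>3\<close> replaced by
  1.4 and 1.7.\<close>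

lemma edge_gain_quadruple:
  fixes a b c d :: real
  assumes pos: "0 < a" "0 < b" "0 < c" "0 < d"
    and ord: "d \<le> c" "c \<le> b" "b \<le> a"
    and sum: "a + b + c + d \<le> 2.01"
  shows "edge_gain a b + edge_gain a c + edge_gain a d + edge_gain b c + edge_gain b d
    + edge_gain c d \<le> 1"
proof -
  define A B C D :: real where ABCD: "A = 0.231 / a" "B = 0.231 / b" "C = 0.231 / c" "D = 0.231 / d"
  have le: "0 < A" "A \<le> B" "B \<le> C" "C \<le> D"
    using pos ord by (auto simp: ABCD frac_le)
  have tangent: "0.231 * (2 * t * r - t\<^sup>2 * a) \<le> f * A" "0.231 * (2 * t * r - t\<^sup>2 * b) \<le> f * B"
    "0.231 * (2 * t * r - t\<^sup>2 * c) \<le> f * C" "0.231 * (2 * t * r - t\<^sup>2 * d) \<le> f * D"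
    if "r\<^sup>2 \<le> f" for r t f :: real
    unfolding ABCD by (intro scaled_inverse_ge_tangent pos that; simp)+
  \<comment> \<open>In each fact the left side is the number of edges minus 1, the coefficients are
    the vertex degrees \<open>f\<close>, and the slope \<open>t\<close> is close to the optimal
    value, the sum of the \<open>r\<close> divided by 2.01.\<close>
  have K4: "5 \<le> 3 * A + 3 * B + 3 * C + 3 * D"
    using tangent[of "1.7" 3 "3.38"] sum by (simp add: power2_eq_square)
  have diamond: "4 \<le> 3 * A + 3 * B + 2 * C + 2 * D"
    using tangent(1,2)[of "1.7" 3 "3.08"] tangent(3,4)[of "1.4" 2 "3.08"] sum
    by (simp add: power2_eq_square)
  have paw: "3 \<le> 3 * A + 2 * B + 2 * C + D"
    using tangent(1)[of "1.7" 3 "2.73"] tangent(2,3)[of "1.4" 2 "2.73"] tangent(4)[of 1 1 "2.73"] sum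
    by (simp add: power2_eq_square)
  have star: "2 \<le> 3 * A + B + C + D"
    using tangent(1)[of "1.7" 3 "2.33"] tangent(2-4)[of 1 1 "2.33"] sum
    by (simp add: power2_eq_square)
  have triangle: "2 \<le> 2 * A + 2 * B + 2 * C"
    using tangent(1-3)[of "1.4" 2 "2.08"] sum pos by (simp add: power2_eq_square)
  have path: "1 \<le> 2 * A + B + C"
    using tangent(1)[of "1.4" 2 "1.69"] tangent(2,3)[of 1 1 "1.69"] sum pos
    by (simp add: power2_eq_square)
  \<comment> \<open>The two threshold graphs with at most one edge are settled by a single gain
    being below 1.\<close>
  show ?thesis
    unfolding edge_gain_def ABCD[symmetric] max_def
    using K4 diamond paw star triangle path le by simp
qed

text \<open>If both gains are positive, Cauchy-Schwarz applies with roots 1.4, 1, 1 and slope 1.69,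
  about 3.4 / 2.01. Otherwise at most one gain remains, and it is below 1.\<close>

lemma edge_gain_path:
  fixes p a b :: real
  assumes pos: "0 < p" "0 < a" "0 < b" and sum: "p + a + b \<le> 2.01"
  shows "edge_gain p a + edge_gain p b \<le> 1"
proof -
  define P A B :: real where PAB: "P = 0.231 / p" "A = 0.231 / a" "B = 0.231 / b"
  have "0.231 * (2 * 1.69 * 1.4 - 1.69\<^sup>2 * p) \<le> 2 * P"
    "0.231 * (2 * 1.69 * 1 - 1.69\<^sup>2 * a) \<le> 1 * A"
    "0.231 * (2 * 1.69 * 1 - 1.69\<^sup>2 * b) \<le> 1 * B"
    unfolding PAB by (intro scaled_inverse_ge_tangent pos; simp add: power2_eq_square)+
  hence "1 \<le> 2 * P + A + B"
    using sum by (simp add: power2_eq_square)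
  moreover have "0 < P" "0 < A" "0 < B" using pos by (simp_all add: PAB)
  ultimately show ?thesis
    unfolding edge_gain_def PAB[symmetric] max_def by simp
qed

lemma edge_gain_star:
  fixes p a b c :: real
  assumes pos: "0 < p" "0 < a" "0 < b" "0 < c"
    and sum: "p + a + b \<le> 2.01" "p + a + c \<le> 2.01" "p + b + c \<le> 2.01"
  shows "edge_gain p a + edge_gain p b + edge_gain p c \<le> 1"
proof -
  define P A B C :: real where PABC: "P = 0.231 / p" "A = 0.231 / a" "B = 0.231 / b" "C = 0.231 / c"
  \<comment> \<open>Cauchy-Schwarz against \<open>3p + 2a + 2b + 2c \<le> 6.03\<close>, hence the factors 3 and 2 in the
    denominators.\<close>
  have "0.231 * (2 * 1.2 * 3 - 1.2\<^sup>2 * (3 * p)) \<le> 9 * (0.231 / (3 * p))"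
    "0.231 * (2 * 1.2 * 1.414 - 1.2\<^sup>2 * (2 * a)) \<le> 2 * (0.231 / (2 * a))"
    "0.231 * (2 * 1.2 * 1.414 - 1.2\<^sup>2 * (2 * b)) \<le> 2 * (0.231 / (2 * b))"
    "0.231 * (2 * 1.2 * 1.414 - 1.2\<^sup>2 * (2 * c)) \<le> 2 * (0.231 / (2 * c))"
    by (intro scaled_inverse_ge_tangent; use pos in \<open>simp add: power2_eq_square\<close>)+
  moreover have "9 * (0.231 / (3 * p)) = 3 * P"
    "2 * (0.231 / (2 * a)) = A" "2 * (0.231 / (2 * b)) = B" "2 * (0.231 / (2 * c)) = C"
    using pos by (simp_all add: PABC)
  ultimately have "2 \<le> 3 * P + A + B + C"
    using sum by (simp add: power2_eq_square)
  \<comment> \<open>These handle the cases in which some gain vanishes.\<close>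
  moreover have "edge_gain p a + edge_gain p b \<le> 1" "edge_gain p a + edge_gain p c \<le> 1"
    "edge_gain p b + edge_gain p c \<le> 1"
    using edge_gain_path pos sum by blast+
  ultimately show ?thesis
    unfolding edge_gain_def PABC[symmetric] max_def by (simp split: if_splits)
qed

lemma ex_antimono_enumeration_4:
  fixes f :: "'a \<Rightarrow> 'b::linorder"
  assumes "finite K" "card K = 4"
  obtains a b c d where "K = {a, b, c, d}" "distinct [a, b, c, d]" "f d \<le> f c" "f c \<le> f b" "f b \<le> f a"
proof -
  obtain ys where ys: "set ys = K" "distinct ys"
    using finite_distinct_list[OF \<open>finite K\<close>] by blast
  define xs where "xs = sort_key f ys"
  have "set xs = K" "distinct xs" "sorted (map f xs)"
    using ys by (simp_all add: xs_def)
  moreover from this have "length xs = 4"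
    using assms distinct_card by metis
  then obtain d c b a where "xs = [d, c, b, a]"
    by (auto simp: numeral_eq_Suc length_Suc_conv)
  ultimately show thesis
    by (intro that[of a b c d]) auto
qed

section \<open>Edges, cliques and degrees of a saturated graph\<close>

locale saturated_graph =
  fixes V :: "'a set" and E :: "'a set set"
  assumes graph: "finite_simple_graph V E" and saturated: "saturated_2_4 V E"
begin

definition nbrs :: "'a \<Rightarrow> 'a set" where
  "nbrs u = {w \<in> V. {u, w} \<in> E}"

definition deg :: "'a \<Rightarrow> nat" where
  "deg u = card (nbrs u)"

definition mult :: "'a set \<Rightarrow> nat" where
  "mult e = card {K \<in> cliques 4 V E. e \<subseteq> K}"

text \<open>With 3000, the heavy edges number at most 0.001 n^2 when there are fewer 4-cliques than
  edges; this is the gap between 0.231 and 0.232.\<close>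

definition light :: "'a set \<Rightarrow> bool" where
  "light e \<longleftrightarrow> mult e \<le> 3000"

definition weight :: "'a set \<Rightarrow> real" where
  "weight e = 1 - 0.231 * real (card V) * (\<Sum>u\<in>e. 1 / real (deg u))"

lemma finite_V: "finite V"
  using graph by (simp add: finite_simple_graph_def)

lemma edgeD: "e \<in> E \<Longrightarrow> e \<subseteq> V \<and> finite e \<and> card e = 2"
  using graph by (auto simp: finite_simple_graph_def nsets_def)

lemma edge_neq: "{u, w} \<in> E \<Longrightarrow> u \<noteq> w"
  by (auto dest: edgeD)

lemma finite_E: "finite E"
  using graph finite_imp_finite_nsets[OF finite_V] finite_subset
  by (auto simp: finite_simple_graph_def)

lemma cliqueD:
  assumes "K \<in> cliques 4 V E"
  shows "K \<subseteq> V" "finite K" "card K = 4" "\<And>u w. u \<in> K \<Longrightarrow> w \<in> K \<Longrightarrow> u \<noteq> w \<Longrightarrow> {u, w} \<in> E"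
  using assms by (auto simp: cliques_def nsets_def clique_def)

lemma finite_cliques: "finite (cliques 4 V E)"
  using finite_imp_finite_nsets[OF finite_V, of 4] by (simp add: cliques_def)

lemma mult_pos: "e \<in> E \<Longrightarrow> 0 < mult e"
  using saturated finite_cliques by (auto simp: saturated_2_4_def mult_def card_gt_0_iff)

lemma deg_pos: "{u, w} \<in> E \<Longrightarrow> 0 < deg u"
  using finite_V by (auto simp: deg_def nbrs_def card_gt_0_iff dest: edgeD)

lemma deg_eq_sum: "deg u = (\<Sum>w\<in>V. of_bool (w \<in> nbrs u))"
proof -
  have "V \<inter> nbrs u = nbrs u" by (auto simp: nbrs_def)
  thus ?thesis using finite_V by (simp add: deg_def)
qed

lemma sum_of_bool_mem: "S \<subseteq> V \<Longrightarrow> (\<Sum>w\<in>V. of_bool (w \<in> S)) = card S"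
  using finite_V by (simp add: Int_absorb1)

section \<open>Common neighbours and degree sums\<close>

text \<open>Each common neighbour completes the triangle to a different 4-clique through
  \<open>{a, b}\<close>.\<close>

lemma card_common_nbrs_le_mult:
  assumes "{a, b} \<in> E" "{a, c} \<in> E" "{b, c} \<in> E"
  shows "card (nbrs a \<inter> nbrs b \<inter> nbrs c) \<le> mult {a, b}"
  unfolding mult_def
proof (rule card_inj_on_le)
  have neq: "a \<noteq> b" "a \<noteq> c" "b \<noteq> c" using assms edge_neq by auto
  have w_neq: "w \<noteq> a \<and> w \<noteq> b \<and> w \<noteq> c" if "w \<in> nbrs a \<inter> nbrs b \<inter> nbrs c" for w
    using that edge_neq[of a w] edge_neq[of b w] edge_neq[of c w] by (auto simp: nbrs_def)
  show "inj_on (\<lambda>w. {a, b, c, w}) (nbrs a \<inter> nbrs b \<inter> nbrs c)"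
    using w_neq by (intro inj_onI) blast
  show "(\<lambda>w. {a, b, c, w}) ` (nbrs a \<inter> nbrs b \<inter> nbrs c) \<subseteq> {K \<in> cliques 4 V E. {a, b} \<subseteq> K}"
  proof (rule image_subsetI)
    fix w assume w: "w \<in> nbrs a \<inter> nbrs b \<inter> nbrs c"
    have "{a, b, c, w} \<subseteq> V" using w assms edgeD by (auto simp: nbrs_def)
    moreover have "card {a, b, c, w} = 4" using w_neq[OF w] neq by auto
    moreover have "clique {a, b, c, w} E"
      using w assms by (auto simp: clique_def nbrs_def insert_commute)
    ultimately show "{a, b, c, w} \<in> {K \<in> cliques 4 V E. {a, b} \<subseteq> K}"
      by (simp add: cliques_def nsets_def)
  qed
  show "finite {K \<in> cliques 4 V E. {a, b} \<subseteq> K}" using finite_cliques by simp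
qed

lemma card_common_nbrs_le:
  assumes "{a, b} \<in> E" "{a, c} \<in> E" "{b, c} \<in> E"
    and "light {a, b} \<or> light {a, c} \<or> light {b, c}"
  shows "card (nbrs a \<inter> nbrs b \<inter> nbrs c) \<le> 3000"
proof -
  have "card (nbrs a \<inter> nbrs b \<inter> nbrs c) \<le> mult {a, b}"
    using card_common_nbrs_le_mult[of a b c] assms by simp
  moreover have "card (nbrs a \<inter> nbrs b \<inter> nbrs c) \<le> mult {a, c}"
    using card_common_nbrs_le_mult[of a c b] assms by (simp add: insert_commute Int_ac)
  moreover have "card (nbrs a \<inter> nbrs b \<inter> nbrs c) \<le> mult {b, c}"
    using card_common_nbrs_le_mult[of b c a] assms by (simp add: insert_commute Int_ac)
  ultimately show ?thesis using assms(4) by (auto simp: light_def)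
qed

text \<open>Count adjacencies vertex by vertex: only a common neighbour of all three contributes
  more than 2.\<close>

lemma deg_sum_triangle:
  "deg a + deg b + deg c \<le> 2 * card V + card (nbrs a \<inter> nbrs b \<inter> nbrs c)"
proof -
  let ?S = "nbrs a \<inter> nbrs b \<inter> nbrs c"
  have "deg a + deg b + deg c
      = (\<Sum>w\<in>V. of_bool (w \<in> nbrs a) + of_bool (w \<in> nbrs b) + of_bool (w \<in> nbrs c))"
    by (simp only: deg_eq_sum sum.distrib)
  also have "\<dots> \<le> (\<Sum>w\<in>V. 2 + of_bool (w \<in> ?S))"
    by (rule sum_mono) auto
  also have "\<dots> = 2 * card V + card ?S"
  proof -
    have "?S \<subseteq> V" by (auto simp: nbrs_def)
    thus ?thesis by (simp only: sum.distrib sum_of_bool_mem) simp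
  qed
  finally show ?thesis .
qed

text \<open>A vertex adjacent to three or four of them contributes at most 2 beyond the allowance of
  2, and it lies in one of the triple intersections.\<close>

lemma deg_sum_quadruple:
  "deg a + deg b + deg c + deg d \<le> 2 * card V
    + 2 * (card (nbrs a \<inter> nbrs b \<inter> nbrs c) + card (nbrs a \<inter> nbrs b \<inter> nbrs d)
      + card (nbrs a \<inter> nbrs c \<inter> nbrs d) + card (nbrs b \<inter> nbrs c \<inter> nbrs d))"
proof -
  let ?S = "nbrs a \<inter> nbrs b \<inter> nbrs c" and ?T = "nbrs a \<inter> nbrs b \<inter> nbrs d"
    and ?S' = "nbrs a \<inter> nbrs c \<inter> nbrs d" and ?T' = "nbrs b \<inter> nbrs c \<inter> nbrs d"
  have "deg a + deg b + deg c + deg d = (\<Sum>w\<in>V. of_bool (w \<in> nbrs a) + of_bool (w \<in> nbrs b)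
      + of_bool (w \<in> nbrs c) + of_bool (w \<in> nbrs d))"
    by (simp only: deg_eq_sum sum.distrib)
  also have "\<dots> \<le> (\<Sum>w\<in>V. 2 + 2 * (of_bool (w \<in> ?S) + of_bool (w \<in> ?T) + of_bool (w \<in> ?S')
      + of_bool (w \<in> ?T')))"
    by (rule sum_mono) auto
  also have "\<dots> = 2 * card V + 2 * (card ?S + card ?T + card ?S' + card ?T')"
  proof -
    have "?S \<subseteq> V" "?T \<subseteq> V" "?S' \<subseteq> V" "?T' \<subseteq> V" by (auto simp: nbrs_def)
    thus ?thesis by (simp only: sum.distrib sum_distrib_left[symmetric] sum_of_bool_mem) simp
  qed
  finally show ?thesis .
qed

section \<open>The weight received by one clique\<close>

lemma weight_le_edge_gain:
  assumes "{u, w} \<in> E"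
  shows "weight {u, w} \<le> edge_gain (deg u / card V) (deg w / card V)"
proof -
  have "0.231 / (deg v / card V) = 0.231 * card V * (1 / real (deg v))" for v by simp
  thus ?thesis
    using edge_neq[OF assms] by (simp add: weight_def edge_gain_def distrib_left)
qed

lemma clique_gain_le_1:
  assumes n: "2400000 \<le> card V" and K: "K \<in> cliques 4 V E"
  shows "(\<Sum>e | e \<in> E \<and> light e \<and> e \<subseteq> K. weight e / mult e) \<le> 1"
proof -
  define x where "x u = real (deg u) / card V" for u
  \<comment> \<open>Discarding negative weights and heavy edges makes it possible to sum over all
    six pairs of \<open>K\<close>.\<close>
  define \<phi> where "\<phi> e = (if light e then max 0 (weight e) else 0)" for e
  obtain a b c d where Kabcd: "K = {a, b, c, d}" and dist: "distinct [a, b, c, d]"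
    and ord: "deg d \<le> deg c" "deg c \<le> deg b" "deg b \<le> deg a"
    using ex_antimono_enumeration_4[OF cliqueD(2,3)[OF K], of deg] by blast
  have edge: "{u, w} \<in> E" if "u \<in> K" "w \<in> K" "u \<noteq> w" for u w
    using cliqueD(4)[OF K] that by blast
  have npos: "0 < card V" using n by simp
  have xpos: "0 < x u" if u: "u \<in> K" for u
  proof -
    obtain w where "w \<in> K" "w \<noteq> u" using Kabcd dist by auto
    hence "0 < deg u" using deg_pos edge u by blast
    thus ?thesis using npos by (simp add: x_def)
  qed
  have \<phi>_nonneg: "0 \<le> \<phi> e" for e by (simp add: \<phi>_def)
  have \<phi>_le: "\<phi> {u, w} \<le> edge_gain (x u) (x w)" if "u \<in> K" "w \<in> K" "u \<noteq> w" for u w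
    using weight_le_edge_gain[OF edge[OF that]] edge_gain_nonneg by (simp add: \<phi>_def x_def)
  have \<phi>_heavy: "\<phi> e = 0" if "\<not> light e" for e using that by (simp add: \<phi>_def)
  have common: "card (nbrs u \<inter> nbrs v \<inter> nbrs w) \<le> 3000"
    if "u \<in> K" "v \<in> K" "w \<in> K" "distinct [u, v, w]"
      "light {u, v} \<or> light {u, w} \<or> light {v, w}" for u v w
    using that by (intro card_common_nbrs_le edge) auto
  have triple: "x u + x v + x w \<le> 2.01"
    if "u \<in> K" "v \<in> K" "w \<in> K" "distinct [u, v, w]"
      "light {u, v} \<or> light {u, w} \<or> light {v, w}" for u v w
  proof -
    have "deg u + deg v + deg w \<le> 2 * card V + 3000"
      using deg_sum_triangle[of u v w] common[OF that] by linarith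
    hence "real (deg u) + deg v + deg w \<le> 2.01 * card V" using n by simp
    thus ?thesis using npos by (simp add: x_def field_simps)
  qed
  \<comment> \<open>When \<open>u\<close>, \<open>v\<close>, \<open>w\<close> span a heavy triangle,
    only the edges at \<open>p\<close> can contribute.\<close>
  have star: "\<phi> {p, u} + \<phi> {p, v} + \<phi> {p, w} + \<phi> {u, v} + \<phi> {u, w} + \<phi> {v, w} \<le> 1"
    if mem: "p \<in> K" "u \<in> K" "v \<in> K" "w \<in> K" and dist: "distinct [p, u, v, w]"
      and heavy: "\<not> light {u, v}" "\<not> light {u, w}" "\<not> light {v, w}" for p u v w
  proof -
    have le: "\<phi> {p, u} \<le> edge_gain (x p) (x u)" "\<phi> {p, v} \<le> edge_gain (x p) (x v)"
      "\<phi> {p, w} \<le> edge_gain (x p) (x w)"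
      using \<phi>_le mem dist by auto
    have le1: "\<phi> {p, u} \<le> 1" "\<phi> {p, v} \<le> 1" "\<phi> {p, w} \<le> 1"
      using le edge_gain_le_1[OF xpos xpos] mem by (meson order_trans)+
    have path: "\<phi> {p, u} + \<phi> {p, v} \<le> 1" "\<phi> {p, u} + \<phi> {p, w} \<le> 1" "\<phi> {p, v} + \<phi> {p, w} \<le> 1"
    proof -
      have "\<phi> {p, s} + \<phi> {p, t} \<le> 1"
        if "s \<in> K" "t \<in> K" "distinct [p, s, t]" for s t
      \<comment> \<open>A light edge bounds the degree sum of the triangle; a heavy one leaves a
        single term, at most 1.\<close>
      proof (cases "light {p, s}")
        case True
        hence "x p + x s + x t \<le> 2.01" using triple[of p s t] that mem by auto
        thus ?thesis
          using edge_gain_path[OF xpos xpos xpos, of p s t] \<phi>_le[of p s] \<phi>_le[of p t] that mem by auto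
      next
        case False
        thus ?thesis
          using \<phi>_heavy \<phi>_le[of p t] edge_gain_le_1[OF xpos xpos, of p t] that mem by auto
      qed
      thus "\<phi> {p, u} + \<phi> {p, v} \<le> 1" "\<phi> {p, u} + \<phi> {p, w} \<le> 1" "\<phi> {p, v} + \<phi> {p, w} \<le> 1"
        using mem dist by auto
    qed
    have "\<phi> {p, u} + \<phi> {p, v} + \<phi> {p, w} \<le> 1"
    proof (cases "light {p, u} \<and> light {p, v} \<and> light {p, w}")
      case True
      hence "x p + x u + x v \<le> 2.01" "x p + x u + x w \<le> 2.01" "x p + x v + x w \<le> 2.01"
        using triple[of p u v] triple[of p u w] triple[of p v w] mem dist by auto
      from edge_gain_star[OF xpos xpos xpos xpos this] le mem show ?thesis by linarith
    next
      case False
      thus ?thesis using \<phi>_heavy path by auto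
    qed
    thus ?thesis using \<phi>_heavy heavy by simp
  qed
  have pairs: "\<phi> {a, b} + \<phi> {a, c} + \<phi> {a, d} + \<phi> {b, c} + \<phi> {b, d} + \<phi> {c, d} \<le> 1"
  proof -
    consider
      (no_heavy_triangle) "light {a, b} \<or> light {a, c} \<or> light {b, c}"
        "light {a, b} \<or> light {a, d} \<or> light {b, d}" "light {a, c} \<or> light {a, d} \<or> light {c, d}"
        "light {b, c} \<or> light {b, d} \<or> light {c, d}"
      | (abc) "\<not> light {a, b}" "\<not> light {a, c}" "\<not> light {b, c}"
      | (abd) "\<not> light {a, b}" "\<not> light {a, d}" "\<not> light {b, d}"
      | (acd) "\<not> light {a, c}" "\<not> light {a, d}" "\<not> light {c, d}"
      | (bcd) "\<not> light {b, c}" "\<not> light {b, d}" "\<not> light {c, d}"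
      by blast
    thus ?thesis
    proof cases
      case no_heavy_triangle
      \<comment> \<open>24000 is 2 * 4 * 3000, and it is at most 0.01 n once n is at least 2400000;
        hence the bound 2.01.\<close>
      have "deg a + deg b + deg c + deg d \<le> 2 * card V + 24000"
        using deg_sum_quadruple[of a b c d] common[of a b c] common[of a b d] common[of a c d]
          common[of b c d] no_heavy_triangle dist Kabcd by simp
      hence "real (deg a) + deg b + deg c + deg d \<le> 2.01 * card V" using n by simp
      hence sum: "x a + x b + x c + x d \<le> 2.01" using npos by (simp add: x_def field_simps)
      have "x d \<le> x c" "x c \<le> x b" "x b \<le> x a"
        using ord by (simp_all add: x_def divide_right_mono)
      from edge_gain_quadruple[OF xpos xpos xpos xpos this sum] Kabcd
      have "edge_gain (x a) (x b) + edge_gain (x a) (x c) + edge_gain (x a) (x d)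
        + edge_gain (x b) (x c) + edge_gain (x b) (x d) + edge_gain (x c) (x d) \<le> 1" by simp
      moreover have "\<phi> {a, b} \<le> edge_gain (x a) (x b)" "\<phi> {a, c} \<le> edge_gain (x a) (x c)"
        "\<phi> {a, d} \<le> edge_gain (x a) (x d)" "\<phi> {b, c} \<le> edge_gain (x b) (x c)"
        "\<phi> {b, d} \<le> edge_gain (x b) (x d)" "\<phi> {c, d} \<le> edge_gain (x c) (x d)"
        using \<phi>_le dist Kabcd by auto
      ultimately show ?thesis by linarith
    next
      case abc
      thus ?thesis using star[of d a b c] dist Kabcd by (auto simp: insert_commute)
    next
      case abd
      thus ?thesis using star[of c a b d] dist Kabcd by (auto simp: insert_commute)
    next
      case acd
      thus ?thesis using star[of b a c d] dist Kabcd by (auto simp: insert_commute)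
    next
      case bcd
      thus ?thesis using star[of a b c d] dist Kabcd by (auto simp: insert_commute)
    qed
  qed
  have edges_K: "{e \<in> E. e \<subseteq> K} = {{a, b}, {a, c}, {a, d}, {b, c}, {b, d}, {c, d}}"
  proof
    show "{e \<in> E. e \<subseteq> K} \<subseteq> {{a, b}, {a, c}, {a, d}, {b, c}, {b, d}, {c, d}}"
    proof
      fix e assume e: "e \<in> {e \<in> E. e \<subseteq> K}"
      then obtain u w where "e = {u, w}" "u \<noteq> w" using edgeD[of e] by (auto simp: card_2_iff)
      with e show "e \<in> {{a, b}, {a, c}, {a, d}, {b, c}, {b, d}, {c, d}}"
        unfolding Kabcd by (auto simp: insert_commute)
    qed
  qed (use edge dist Kabcd in auto)
  have "(\<Sum>e | e \<in> E \<and> light e \<and> e \<subseteq> K. weight e / mult e) \<le> (\<Sum>e | e \<in> E \<and> light e \<and> e \<subseteq> K. \<phi> e)"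
  proof (rule sum_mono)
    fix e assume e: "e \<in> {e. e \<in> E \<and> light e \<and> e \<subseteq> K}"
    \<comment> \<open>This is where saturation enters: dividing by \<open>mult e\<close> cannot
      increase a nonnegative weight.\<close>
    hence "1 \<le> real (mult e)" using mult_pos by (simp add: Suc_leI)
    have "weight e / mult e \<le> max 0 (weight e) / mult e" by (simp add: divide_right_mono)
    also have "\<dots> \<le> max 0 (weight e)"
      using \<open>1 \<le> real (mult e)\<close> by (simp add: pos_divide_le_eq mult_le_cancel_left1)
    finally show "weight e / mult e \<le> \<phi> e" using e by (simp add: \<phi>_def)
  qed
  also have "\<dots> \<le> (\<Sum>e | e \<in> E \<and> e \<subseteq> K. \<phi> e)"
    using finite_E \<phi>_nonneg by (intro sum_mono2) auto
  also have "\<dots> = \<phi> {a, b} + \<phi> {a, c} + \<phi> {a, d} + \<phi> {b, c} + \<phi> {b, d} + \<phi> {c, d}"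
    unfolding edges_K using dist by (simp add: doubleton_eq_iff add_ac)
  finally show ?thesis using pairs by linarith
qed

section \<open>Summation over all edges and cliques\<close>

text \<open>After exchanging the sums, a vertex contributes 1 / \<open>deg u\<close> for each of its
  \<open>deg u\<close> edges: 1 in total, or 0 if it is isolated.\<close>

lemma sum_inverse_deg_le: "(\<Sum>e\<in>E. \<Sum>u\<in>e. 1 / real (deg u)) \<le> card V"
proof -
  have card_incident: "card {e \<in> E. u \<in> e} = deg u" for u
  proof -
    have "bij_betw (\<lambda>w. {u, w}) (nbrs u) {e \<in> E. u \<in> e}"
    proof (rule bij_betwI')
      fix e assume "e \<in> {e \<in> E. u \<in> e}"
      hence e: "e \<in> E" "u \<in> e" by auto
      with edgeD[of e] obtain w where "e = {u, w}" by (auto simp: card_2_iff)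
      thus "\<exists>w\<in>nbrs u. e = {u, w}" using e edgeD[of e] by (auto simp: nbrs_def)
    qed (auto simp: nbrs_def doubleton_eq_iff)
    thus ?thesis by (simp add: deg_def bij_betw_same_card)
  qed
  have "(\<Sum>e\<in>E. \<Sum>u\<in>e. 1 / real (deg u)) = (\<Sum>e\<in>E. \<Sum>u | u \<in> V \<and> u \<in> e. 1 / real (deg u))"
    using edgeD by (intro sum.cong refl) auto
  also have "\<dots> = (\<Sum>u\<in>V. \<Sum>e | e \<in> E \<and> u \<in> e. 1 / real (deg u))"
    by (rule sum.swap_restrict[OF finite_E finite_V])
  also have "\<dots> \<le> (\<Sum>u\<in>V. 1)"
    by (rule sum_mono) (simp add: card_incident)
  finally show ?thesis by simp
qed

text \<open>Double counting of incident pairs of an edge and a 4-clique: a clique has at most 6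
  edges, a heavy edge more than 3000 cliques.\<close>

lemma card_heavy_le: "3000 * card {e \<in> E. \<not> light e} \<le> 6 * card (cliques 4 V E)"
proof -
  have "3000 * card {e \<in> E. \<not> light e} = (\<Sum>e | e \<in> E \<and> \<not> light e. 3000)" by simp
  also have "\<dots> \<le> (\<Sum>e | e \<in> E \<and> \<not> light e. mult e)"
    by (rule sum_mono) (simp add: light_def)
  also have "\<dots> \<le> (\<Sum>e\<in>E. mult e)"
    using finite_E by (intro sum_mono2) auto
  also have "\<dots> = (\<Sum>e\<in>E. \<Sum>K | K \<in> cliques 4 V E \<and> e \<subseteq> K. 1)"
    by (simp add: mult_def)
  also have "\<dots> = (\<Sum>K\<in>cliques 4 V E. \<Sum>e | e \<in> E \<and> e \<subseteq> K. 1)"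
    by (rule sum.swap_restrict[OF finite_E finite_cliques])
  also have "\<dots> \<le> (\<Sum>K\<in>cliques 4 V E. 6)"
  proof (rule sum_mono)
    fix K assume K: "K \<in> cliques 4 V E"
    have "{e. e \<in> E \<and> e \<subseteq> K} \<subseteq> {e. e \<subseteq> K \<and> card e = 2}" using edgeD by auto
    hence "card {e. e \<in> E \<and> e \<subseteq> K} \<le> card {e. e \<subseteq> K \<and> card e = 2}"
      using cliqueD(2)[OF K] by (intro card_mono) auto
    also have "\<dots> = 4 choose 2" using n_subsets[OF cliqueD(2)[OF K]] cliqueD(3)[OF K] by simp
    finally show "(\<Sum>e | e \<in> E \<and> e \<subseteq> K. 1) \<le> (6::nat)" by (simp add: choose_two)
  qed
  finally show ?thesis by simp
qed

lemma card_E_le: "2 * card E \<le> (card V)\<^sup>2"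
proof -
  have "card E \<le> card ([V]\<^bsup>2\<^esup>)"
    using graph finite_imp_finite_nsets[OF finite_V, of 2]
    by (intro card_mono) (simp_all add: finite_simple_graph_def)
  also have "\<dots> = card V choose 2" using card_nsets by blast
  finally show ?thesis
    by (simp add: choose_two power2_eq_square diff_mult_distrib2)
qed

lemma card_E_minus_card_cliques_le:
  assumes n: "2400000 \<le> card V"
  shows "real (card E) - real (card (cliques 4 V E)) \<le> 0.232 * (real (card V))\<^sup>2"
proof (cases "card E \<le> card (cliques 4 V E)")
  case True
  thus ?thesis by (simp add: order_trans[of _ 0])
next
  case False
  let ?L = "{e \<in> E. light e}" and ?H = "{e \<in> E. \<not> light e}" and ?n = "real (card V)"
  have finL: "finite ?L" using finite_E by simp
  have "real (card ?L) - 0.231 * ?n * (\<Sum>e\<in>?L. \<Sum>u\<in>e. 1 / real (deg u)) = (\<Sum>e\<in>?L. weight e)"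
    by (simp add: weight_def sum_subtractf sum_distrib_left)
  \<comment> \<open>Each light edge splits its weight equally among its cliques, of which there is
    at least one.\<close>
  also have "\<dots> = (\<Sum>e\<in>?L. \<Sum>K | K \<in> cliques 4 V E \<and> e \<subseteq> K. weight e / mult e)"
    using mult_pos by (intro sum.cong refl) (fastforce simp: mult_def[symmetric])
  also have "\<dots> = (\<Sum>K\<in>cliques 4 V E. \<Sum>e | e \<in> ?L \<and> e \<subseteq> K. weight e / mult e)"
    by (rule sum.swap_restrict[OF finL finite_cliques])
  also have "\<dots> \<le> (\<Sum>K\<in>cliques 4 V E. 1)"
    using clique_gain_le_1[OF n] by (intro sum_mono) (simp add: conj_ac)
  finally have "real (card ?L) - 0.231 * ?n * (\<Sum>e\<in>?L. \<Sum>u\<in>e. 1 / real (deg u))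
    \<le> card (cliques 4 V E)" by simp
  moreover have "0.231 * ?n * (\<Sum>e\<in>?L. \<Sum>u\<in>e. 1 / real (deg u)) \<le> 0.231 * ?n * ?n"
  proof (rule mult_left_mono)
    have "(\<Sum>e\<in>?L. \<Sum>u\<in>e. 1 / real (deg u)) \<le> (\<Sum>e\<in>E. \<Sum>u\<in>e. 1 / real (deg u))"
      using finite_E by (intro sum_mono2) (auto intro: sum_nonneg)
    thus "(\<Sum>e\<in>?L. \<Sum>u\<in>e. 1 / real (deg u)) \<le> ?n" using sum_inverse_deg_le by linarith
  qed simp
  moreover have "card E = card ?L + card ?H"
    using finite_E by (subst card_Un_disjoint[symmetric]) (auto intro: arg_cong[where f = card])
  moreover have "1000 * real (card ?H) \<le> ?n\<^sup>2"
  proof -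
    \<comment> \<open>Here 3000 |H| \<le> 6 |C| with |C| < |E| \<le> n^2 / 2, where H is the set of
      heavy edges and C that of 4-cliques.\<close>
    have "1000 * card ?H \<le> (card V)\<^sup>2" using card_heavy_le False card_E_le by linarith
    thus ?thesis by (metis of_nat_le_iff of_nat_mult of_nat_numeral of_nat_power)
  qed
  ultimately show ?thesis by (simp add: power2_eq_square)
qed

end

section \<open>The asymptotic statement\<close>

theorem theorem12:
  shows "\<exists>\<epsilon> :: nat \<Rightarrow> real. \<epsilon> \<longlonglongrightarrow> 0 \<and>
    (\<forall>n. \<forall>(V :: 'a set) E.
      finite_simple_graph V E \<and> saturated_2_4 V E \<and> card V = n \<longrightarrow>
        real (card E) - real (card (cliques 4 V E))
          \<le> (2 * (39 + sqrt 21) / 375 + \<epsilon> n) * (real n)\<^sup>2) \<and>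
    (\<forall>n\<ge>1. (2 * (39 + sqrt 21) / 375 + \<epsilon> n) * (real n)\<^sup>2
          < (0.232441 + \<epsilon> n) * (real n)\<^sup>2)"
proof -
  \<comment> \<open>For large n the bound 0.232 n^2 needs no error term; for small n the value 1
    suffices because |E| \<le> n^2 / 2.\<close>
  define \<epsilon> :: "nat \<Rightarrow> real" where "\<epsilon> n = (if 2400000 \<le> n then 0 else 1)" for n
  \<comment> \<open>Replacing the root by 4.5 turns the constant into exactly 0.232.\<close>
  have sqrt_ge: "4.5 \<le> sqrt 21" by (rule real_le_rsqrt) (simp add: power2_eq_square)
  have sqrt_less: "sqrt 21 < 4.58268" by (rule real_less_lsqrt) (simp_all add: power2_eq_square)
  have "\<epsilon> \<longlonglongrightarrow> 0"
  proof (rule tendsto_eventually)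
    show "\<forall>\<^sub>F n in sequentially. \<epsilon> n = 0"
      using eventually_ge_at_top[of "2400000::nat"] by eventually_elim (simp add: \<epsilon>_def)
  qed
  moreover have "real (card E) - real (card (cliques 4 V E))
      \<le> (2 * (39 + sqrt 21) / 375 + \<epsilon> n) * (real n)\<^sup>2"
    if "finite_simple_graph V E" "saturated_2_4 V E" "card V = n" for n and V :: "'a set" and E
  proof -
    interpret saturated_graph V E using that by unfold_locales
    have "real (card E) - real (card (cliques 4 V E)) \<le> (0.232 + \<epsilon> n) * (real n)\<^sup>2"
    proof (cases "2400000 \<le> n")
      case True
      thus ?thesis using card_E_minus_card_cliques_le that by (simp add: \<epsilon>_def)
    next
      case False
      have "2 * real (card E) \<le> (real n)\<^sup>2"
        using card_E_le that by (metis of_nat_le_iff of_nat_mult of_nat_numeral of_nat_power)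
      thus ?thesis using False by (simp add: \<epsilon>_def)
    qed
    also have "\<dots> \<le> (2 * (39 + sqrt 21) / 375 + \<epsilon> n) * (real n)\<^sup>2"
      using sqrt_ge by (intro mult_right_mono) simp_all
    finally show ?thesis .
  qed
  moreover have "(2 * (39 + sqrt 21) / 375 + \<epsilon> n) * (real n)\<^sup>2 < (0.232441 + \<epsilon> n) * (real n)\<^sup>2"
    if "n \<ge> 1" for n
    using sqrt_less that by (intro mult_strict_right_mono) simp_all
  ultimately show ?thesis by blast
qed

end
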